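(* Let $(V,\nu,\tau,\tau^* )$ be a PN space and let $f\colon V\to V$ be a linear $C$-contraction. Then $f$ is uniformly continuous, i.e. for every $\epsilon>0$ there is $\delta>0$ such that for all $p,q\in V$, $p-q\in N_\theta(\delta)$ implies $fp-fq\in N_\theta(\epsilon)$.
   Context: A distance distribution function (d.d.f.) is a nondecreasing function $F\colon[0,+\infty]\to[0,1]$, left-continuous on $(0,+\infty)$, with $F(0)=0$ and $F(+\infty)=1$; $\Delta^+$ is the set of all d.d.f.'s, ordered pointwise and endowed with the topology of weak convergence (metrized by Sibley's metric). $\varepsilon_0\in\Delta^+$ is the d.d.f. with $\varepsilon_0(0)=0$ and $\varepsilon_0(x)=1$ for $x>0$. A triangle function is a map $\tau\colon\Delta^+\times\Delta^+\to\Delta^+$ that is commutative, associative, nondecreasing in each variable, and has $\varepsilon_0$ as identity. A PN space $(V,\nu,\tau,\tau^* )$ consists of a real vector space $V$ (null vector $\theta$), a map $\nu\colon V\to\Delta^+$, $p\mapsto\nu_p$, and triangle functions $\tau,\tau^*$, with $\tau$ continuous, such that for all $p,q\in V$: (N1) $\nu_p=\varepsilon_0$ if and only if $p=\theta$; (N2) $\nu_{-p}=\nu_p$; (N3) $\nu_{p+q}\ge\tau(\nu_p,\nu_q)$; (N4) $\nu_p\le\tau^*(\nu_{\lambda p},\nu_{(1-\lambda)p})$ for every $\lambda\in[0,1]$. For $p\in V$ and $t>0$, $N_p(t)=\{q\in V\colon \nu_{p-q}(t)>1-t\}$; these neighborhoods determine the strong topology (and uniformity) on $V$. A map $f\colon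 V\to V$ is a $C$-contraction if there exists $k\in(0,1)$ such that for all $p\in V$ and $t>0$: $\nu_p(t)>1-t$ implies $\nu_{fp}(kt)>1-kt$. *)

theory Defs
  imports "HOL-Analysis.Analysis"
begin

section \<open>Distance distribution functions\<close>

lemma continuous_at_left_step:
  assumes "0 < x"
  shows "continuous (at_left x) (\<lambda>x::ennreal. if 0 < x then 1 else 0 :: real)"
proof -
  have "\<forall>\<^sub>F y in at_left x. (if 0 < y then 1 else 0 :: real) = 1"
    using assms by (auto simp: eventually_at_left[OF assms] intro: exI[of _ 0])
  then show ?thesis
    using assms by (simp add: continuous_within tendsto_eventually)
qed

typedef ddf = "{F :: ennreal \<Rightarrow> real.
    mono F \<and> (\<forall>x. F x \<in> {0..1}) \<and>
    (\<forall>x. 0 < x \<and> x < \<infinity> \<longrightarrow> continuous (at_left x) F) \<and>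
    F 0 = 0 \<and> F \<infinity> = 1}"
  morphisms ddf_fun Abs_ddf
  by (rule exI[of _ "\<lambda>x. if 0 < x then 1 else 0"])
    (use continuous_at_left_step in \<open>auto simp: mono_def\<close>)

definition eps0 :: ddf where
  "eps0 = Abs_ddf (\<lambda>x. if 0 < x then 1 else 0)"

lemma eps0_fun: "ddf_fun eps0 = (\<lambda>x. if 0 < x then 1 else 0)"
  unfolding eps0_def
  by (rule Abs_ddf_inverse) (use continuous_at_left_step in \<open>auto simp: mono_def\<close>)

lemma ddf_mono: "x \<le> y \<Longrightarrow> ddf_fun F x \<le> ddf_fun F y"
  using ddf_fun[of F] by (auto simp: mono_def)

lemma ddf_ge_0 [simp]: "0 \<le> ddf_fun F x" and ddf_le_1 [simp]: "ddf_fun F x \<le> 1"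
  using ddf_fun[of F] by auto

lemma ddf_0 [simp]: "ddf_fun F 0 = 0" and ddf_infinity [simp]: "ddf_fun F \<infinity> = 1"
  using ddf_fun[of F] by auto

lemma ddf_left_lower:
  assumes "0 < x" "c < ddf_fun F (ennreal x)"
  obtains y where "0 < y" "y < x" "c < ddf_fun F (ennreal y)"
proof -
  have "continuous (at_left (ennreal x)) (ddf_fun F)"
    using ddf_fun[of F] assms(1) by (auto simp: less_top)
  then have "\<forall>\<^sub>F y in at_left (ennreal x). c < ddf_fun F y"
    using assms(2) by (auto simp: continuous_within dest: order_tendstoD)
  then obtain b where b: "b < ennreal x" "\<And>y. b < y \<Longrightarrow> y < ennreal x \<Longrightarrow> c < ddf_fun F y"
    using assms(1) by (auto simp: eventually_at_left[of 0])
  obtain z where z: "b < z" "z < ennreal x"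
    using dense[OF b(1)] by blast
  have z0: "0 < z" and zt: "z < top"
    using z by (auto simp: less_top intro: le_less_trans less_trans)
  have eq: "ennreal (enn2real z) = z"
    using zt by simp
  have "0 < enn2real z"
    using z0 zt by (simp add: enn2real_positive_iff)
  moreover have "enn2real z < x"
    using z(2) eq assms(1) by (metis ennreal_less_iff enn2real_nonneg)
  ultimately show thesis
    using that b(2)[OF z] eq by metis
qed

lemma ddf_eqI:
  assumes "\<And>x. 0 < x \<Longrightarrow> ddf_fun F (ennreal x) = ddf_fun G (ennreal x)"
  shows "F = G"
proof -
  have "ddf_fun F x = ddf_fun G x" for x
  proof (cases x)
    case (real r)
    then show ?thesis
      using assms[of r] by (cases "r = 0") auto
  next
    case top
    then show ?thesis
      using ddf_infinity by simp
  qed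
  then show ?thesis
    by (metis ddf_fun_inverse ext)
qed

instantiation ddf :: order
begin

definition less_eq_ddf :: "ddf \<Rightarrow> ddf \<Rightarrow> bool" where
  "F \<le> G \<longleftrightarrow> (\<forall>x. ddf_fun F x \<le> ddf_fun G x)"

definition less_ddf :: "ddf \<Rightarrow> ddf \<Rightarrow> bool" where
  "less_ddf F G \<longleftrightarrow> F \<le> G \<and> \<not> G \<le> F"

instance
proof
  fix F G H :: ddf
  show "F < G \<longleftrightarrow> F \<le> G \<and> \<not> G \<le> F"
    by (rule less_ddf_def)
  show "F \<le> F"
    by (simp add: less_eq_ddf_def)
  show "F \<le> G \<Longrightarrow> G \<le> H \<Longrightarrow> F \<le> H"
    unfolding less_eq_ddf_def by (meson order_trans)
  show "F \<le> G \<Longrightarrow> G \<le> F \<Longrightarrow> F = G"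
    unfolding less_eq_ddf_def by (intro ddf_eqI) (auto intro: antisym)
qed

end

section \<open>Sibley's metric and weak convergence\<close>

text \<open>
  Sibley's modified Levy metric, in the one-sided form used by Schweizer and Sklar. The bound
  \<open>x < 1 / h\<close> only allows control on bounded sets, so that mass may escape to infinity in a limit.
\<close>

definition sibley_cond :: "ddf \<Rightarrow> ddf \<Rightarrow> real \<Rightarrow> bool" where
  "sibley_cond F G h \<longleftrightarrow>
    (\<forall>x. 0 < x \<and> x < 1 / h \<longrightarrow> ddf_fun G (ennreal x) \<le> ddf_fun F (ennreal (x + h)) + h)"

lemma sibley_cond_1: "sibley_cond F G 1"
  unfolding sibley_cond_def by (simp add: add_increasing)

lemma sibley_cond_mono:
  assumes "sibley_cond F G h" "0 < h" "h \<le> k"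
  shows "sibley_cond F G k"
  unfolding sibley_cond_def
proof safe
  fix x assume x: "0 < x" "x < 1 / k"
  have "x < 1 / h"
    using x assms by (meson frac_le less_le_trans order_refl zero_le_one)
  then have "ddf_fun G (ennreal x) \<le> ddf_fun F (ennreal (x + h)) + h"
    using assms(1) x by (simp add: sibley_cond_def)
  also have "\<dots> \<le> ddf_fun F (ennreal (x + k)) + k"
    using assms by (intro add_mono ddf_mono ennreal_leI) auto
  finally show "ddf_fun G (ennreal x) \<le> ddf_fun F (ennreal (x + k)) + k" .
qed

lemma sibley_cond_trans:
  assumes "sibley_cond F G h" "sibley_cond G H k" "0 < h" "0 < k" "h + k \<le> 1"
  shows "sibley_cond F H (h + k)"
  unfolding sibley_cond_def
proof safe
  fix x assume x: "0 < x" "x < 1 / (h + k)"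
  have "1 / (h + k) \<le> 1 / k"
    using assms by (simp add: frac_le)
  then have 1: "ddf_fun H (ennreal x) \<le> ddf_fun G (ennreal (x + k)) + k"
    using assms(2) x by (simp add: sibley_cond_def)
  have "h * (h + k) \<le> 1"
    using assms by (intro mult_le_one) auto
  then have "k * (h * (h + k)) \<le> k"
    using assms by (simp add: mult_left_le)
  then have "1 / (h + k) + k \<le> 1 / h"
    using assms by (simp add: field_simps)
  then have "ddf_fun G (ennreal (x + k)) \<le> ddf_fun F (ennreal (x + k + h)) + h"
    using assms x by (simp add: sibley_cond_def del: ennreal_plus)
  with 1 show "ddf_fun H (ennreal x) \<le> ddf_fun F (ennreal (x + (h + k))) + (h + k)"
    by (simp add: algebra_simps)
qed

instantiation ddf :: metric_space
begin

definition dist_ddf :: "ddf \<Rightarrow> ddf \<Rightarrow> real" where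
  "dist F G = Inf {h. 0 < h \<and> h \<le> 1 \<and> sibley_cond F G h \<and> sibley_cond G F h}"

definition uniformity_ddf :: "(ddf \<times> ddf) filter" where
  "uniformity_ddf = (INF e\<in>{0<..}. principal {(F, G). dist F G < e})"

definition open_ddf :: "ddf set \<Rightarrow> bool" where
  "open_ddf U \<longleftrightarrow> (\<forall>F\<in>U. \<forall>\<^sub>F (F', G) in uniformity. F' = F \<longrightarrow> G \<in> U)"

lemma dist_ddf_le:
  assumes "0 < h" "h \<le> 1" "sibley_cond F G h" "sibley_cond G F h"
  shows "dist F G \<le> h"
  unfolding dist_ddf_def using assms by (intro cInf_lower bdd_belowI[of _ 0]) auto

lemma dist_ddf_less:
  assumes "dist F G < k"
  obtains h where "0 < h" "h \<le> 1" "h < k" "sibley_cond F G h" "sibley_cond G F h"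
proof -
  have "1 \<in> {h. 0 < h \<and> h \<le> 1 \<and> sibley_cond F G h \<and> sibley_cond G F h}"
    by (simp add: sibley_cond_1)
  then show thesis
    using cInf_lessD[OF _ assms[unfolded dist_ddf_def]] that by blast
qed

lemma dist_ddf_nonneg: "0 \<le> dist F (G::ddf)"
proof -
  have "1 \<in> {h. 0 < h \<and> h \<le> 1 \<and> sibley_cond F G h \<and> sibley_cond G F h}"
    by (simp add: sibley_cond_1)
  then show ?thesis
    unfolding dist_ddf_def by (intro cInf_greatest) auto
qed

lemma dist_ddf_le_1: "dist F (G::ddf) \<le> 1"
  by (rule dist_ddf_le) (auto simp: sibley_cond_1)

lemma dist_ddf_commute: "dist F G = dist G (F::ddf)"
  unfolding dist_ddf_def by (rule arg_cong[where f = Inf]) auto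

lemma dist_ddf_0_le:
  assumes "dist F G \<le> 0" "0 < x"
  shows "ddf_fun G (ennreal x) \<le> ddf_fun F (ennreal x)"
proof (rule ccontr)
  assume "\<not> ?thesis"
  then have less: "ddf_fun F (ennreal x) < ddf_fun G (ennreal x)"
    by simp
  define e where "e = (ddf_fun G (ennreal x) - ddf_fun F (ennreal x)) / 2"
  have e: "0 < e" "ddf_fun F (ennreal x) + e < ddf_fun G (ennreal x)"
    using less by (auto simp: e_def field_simps)
  obtain y where y: "0 < y" "y < x" "ddf_fun F (ennreal x) + e < ddf_fun G (ennreal y)"
    using ddf_left_lower[OF assms(2) e(2)] by metis
  define k where "k = min e (min (x - y) (1 / (y + 1)))"
  have k: "0 < k" "k \<le> e" "k \<le> x - y" "k \<le> 1 / (y + 1)"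
    using e y by (auto simp: k_def)
  then have "dist F G < k"
    using assms by simp
  then obtain h where h: "0 < h" "h < k" "sibley_cond F G h"
    by (rule dist_ddf_less)
  have "h * (y + 1) < 1"
    using h k y by (simp add: pos_le_divide_eq) (metis le_less_trans less_le_trans mult_strict_right_mono add_pos_pos zero_less_one)
  then have "y < 1 / h"
    using h y by (simp add: field_simps)
  then have "ddf_fun G (ennreal y) \<le> ddf_fun F (ennreal (y + h)) + h"
    using h y by (simp add: sibley_cond_def)
  also have "\<dots> \<le> ddf_fun F (ennreal x) + e"
    using h k by (intro add_mono ddf_mono ennreal_leI) auto
  finally show False
    using y by simp
qed

instance
proof
  fix F G H :: ddf and U :: "ddf set"
  show "(uniformity :: (ddf \<times> ddf) filter) = (INF e\<in>{0<..}. principal {(x, y). dist x y < e})"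
    by (rule uniformity_ddf_def)
  show "open U \<longleftrightarrow> (\<forall>x\<in>U. \<forall>\<^sub>F (x', y) in uniformity. x' = x \<longrightarrow> y \<in> U)"
    by (rule open_ddf_def)
  show "dist F G = 0 \<longleftrightarrow> F = G"
  proof
    assume "dist F G = 0"
    then have "dist F G \<le> 0" "dist G F \<le> 0"
      using dist_ddf_commute[of F G] by simp_all
    then show "F = G"
      by (intro ddf_eqI order.antisym) (blast intro: dist_ddf_0_le)+
  next
    assume [simp]: "F = G"
    have "sibley_cond F F h" if "0 < h" for h
      using that unfolding sibley_cond_def
      by (auto intro!: add_increasing2 ddf_mono ennreal_leI simp del: ennreal_plus)
    then have "dist F F \<le> h" if "0 < h" for h
      using that dist_ddf_le_1[of F F] by (cases "h \<le> 1") (auto intro: dist_ddf_le)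
    then have "dist F F \<le> 0"
      using field_le_epsilon[of "dist F F" 0] by simp
    then show "dist F G = 0"
      using dist_ddf_nonneg[of F F] by simp
  qed
  show "dist F G \<le> dist F H + dist G H"
  proof (rule field_le_epsilon)
    fix e :: real assume e: "0 < e"
    have "dist F H < dist F H + e / 2" "dist G H < dist G H + e / 2"
      using e by auto
    then obtain h k where
      h: "0 < h" "h < dist F H + e / 2" "sibley_cond F H h" "sibley_cond H F h" and
      k: "0 < k" "k < dist G H + e / 2" "sibley_cond G H k" "sibley_cond H G k"
      by (metis dist_ddf_less)
    have "dist F G \<le> h + k"
    proof (cases "h + k \<le> 1")
      case True
      then show ?thesis
        using h k sibley_cond_trans[of F H h G k] sibley_cond_trans[of G H k F h]
        by (intro dist_ddf_le) (auto simp: add.commute)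
    next
      case False
      then show ?thesis
        using dist_ddf_le_1[of F G] by simp
    qed
    then show "dist F G \<le> dist F H + dist G H + e"
      using h k by simp
  qed
qed

end

text \<open>
  The topology induced by \<^const>\<open>dist\<close> is that of weak convergence, that is, of pointwise
  convergence at the points of continuity of the limit.
\<close>

lemma sibley_cond_dist:
  assumes "dist F G < h"
  shows "sibley_cond F G h" "sibley_cond G F h"
  using assms by (metis dist_ddf_less less_imp_le sibley_cond_mono)+

lemma ddf_continuity_point:
  assumes "0 \<le> a" "a < b"
  obtains x where "a < x" "x < b" "isCont (\<lambda>x. ddf_fun F (ennreal x)) x"
proof -
  have "mono (\<lambda>x. ddf_fun F (ennreal x))"
    by (auto simp: mono_def intro!: ddf_mono ennreal_leI)
  then have "countable {x. \<not> isCont (\<lambda>x. ddf_fun F (ennreal x)) x}"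
    by (rule mono_ctble_discont)
  then obtain x where "x \<in> {a<..<b}" "x \<notin> {x. \<not> isCont (\<lambda>x. ddf_fun F (ennreal x)) x}"
    using open_minus_countable[of _ "{a<..<b}"] assms by (metis dense open_greaterThanLessThan greaterThanLessThan_iff empty_iff Diff_iff ex_in_conv)
  then show thesis
    using that by auto
qed

lemma tendsto_ddf_iff:
  "(X \<longlongrightarrow> F) net \<longleftrightarrow>
    (\<forall>x>0. isCont (\<lambda>x. ddf_fun F (ennreal x)) x \<longrightarrow>
      ((\<lambda>n. ddf_fun (X n) (ennreal x)) \<longlongrightarrow> ddf_fun F (ennreal x)) net)"
proof safe
  fix x :: real
  assume lim: "(X \<longlongrightarrow> F) net" and x: "0 < x" and cont: "isCont (\<lambda>x. ddf_fun F (ennreal x)) x"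
  show "((\<lambda>n. ddf_fun (X n) (ennreal x)) \<longlongrightarrow> ddf_fun F (ennreal x)) net"
  proof (rule tendstoI)
    fix e :: real assume e: "0 < e"
    obtain d where d: "0 < d"
      "\<And>y. dist y x < d \<Longrightarrow> dist (ddf_fun F (ennreal y)) (ddf_fun F (ennreal x)) < e / 2"
      using cont e unfolding continuous_at_eps_delta by (metis half_gt_zero)
    define h where "h = min (e / 2) (min (d / 2) (min (x / 2) (1 / (x + 1))))"
    have h: "0 < h" "h \<le> e / 2" "h < d" "h < x" "h \<le> 1 / (x + 1)"
      using e d x by (auto simp: h_def)
    have "h * (x + 1) \<le> 1"
      using h x by (simp add: pos_le_divide_eq)
    then have xh: "x < 1 / h"
      using h x by (simp add: field_simps)
    have "\<forall>\<^sub>F n in net. dist (X n) F < h"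
      using lim h by (simp add: tendsto_iff)
    then show "\<forall>\<^sub>F n in net. dist (ddf_fun (X n) (ennreal x)) (ddf_fun F (ennreal x)) < e"
    proof eventually_elim
      case (elim n)
      have "ddf_fun (X n) (ennreal x) \<le> ddf_fun F (ennreal (x + h)) + h"
        using sibley_cond_dist(2)[OF elim] x xh by (simp add: sibley_cond_def)
      moreover have "ddf_fun F (ennreal (x - h)) \<le> ddf_fun (X n) (ennreal x) + h"
        using sibley_cond_dist(1)[OF elim] h xh unfolding sibley_cond_def
        by (auto dest!: spec[of _ "x - h"] simp del: ennreal_plus)
      moreover have "dist (ddf_fun F (ennreal (x + h))) (ddf_fun F (ennreal x)) < e / 2"
        "dist (ddf_fun F (ennreal (x - h))) (ddf_fun F (ennreal x)) < e / 2"
        using h by (intro d(2), simp add: dist_real_def)+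
      ultimately show ?case
        using h unfolding dist_real_def by linarith
    qed
  qed
next
  assume R: "\<forall>x>0. isCont (\<lambda>x. ddf_fun F (ennreal x)) x \<longrightarrow>
      ((\<lambda>n. ddf_fun (X n) (ennreal x)) \<longlongrightarrow> ddf_fun F (ennreal x)) net"
  show "(X \<longlongrightarrow> F) net"
  proof (rule tendstoI)
    fix e :: real assume e: "0 < e"
    define h where "h = min (e / 2) 1"
    have h: "0 < h" "h < e" "h \<le> 1"
      using e by (auto simp: h_def)
    have "\<exists>a. real j * (h / 2) < a \<and> a < real (Suc j) * (h / 2) \<and>
        isCont (\<lambda>x. ddf_fun F (ennreal x)) a" for j
      by (rule ddf_continuity_point[of "real j * (h / 2)" "real (Suc j) * (h / 2)" F])
        (use h in \<open>auto intro: mult_strict_right_mono\<close>)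
    then obtain a where a: "\<And>j. real j * (h / 2) < a j" "\<And>j. a j < real (Suc j) * (h / 2)"
      "\<And>j. isCont (\<lambda>x. ddf_fun F (ennreal x)) (a j)"
      by metis
    have a0: "0 < a j" for j
      using a(1)[of j] h by (meson half_gt_zero le_less_trans less_imp_le mult_nonneg_nonneg of_nat_0_le_iff)
    obtain N :: nat where N: "1 / h / (h / 2) < real N"
      using reals_Archimedean2 by blast
    have "\<forall>\<^sub>F n in net. dist (ddf_fun (X n) (ennreal (a j))) (ddf_fun F (ennreal (a j))) < h" for j
      using R a0 a(3) h tendstoD by blast
    then have "\<forall>\<^sub>F n in net. \<forall>j\<in>{..Suc N}.
        dist (ddf_fun (X n) (ennreal (a j))) (ddf_fun F (ennreal (a j))) < h"
      by (intro eventually_ball_finite) auto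
    then show "\<forall>\<^sub>F n in net. dist (X n) F < e"
    proof eventually_elim
      case (elim n)
      have step: "sibley_cond G H h"
        if GH: "\<And>j. j \<le> Suc N \<Longrightarrow> ddf_fun H (ennreal (a j)) \<le> ddf_fun G (ennreal (a j)) + h"
        for G H
        unfolding sibley_cond_def
      proof safe
        fix x assume x: "0 < x" "x < 1 / h"
        define j where "j = nat \<lfloor>x / (h / 2)\<rfloor>"
        have j: "real j \<le> x / (h / 2)" "x / (h / 2) < real j + 1"
          using x h by (auto simp: j_def)
        have "x / (h / 2) < 1 / h / (h / 2)"
          using x h by (intro divide_strict_right_mono) auto
        then have "Suc j \<le> Suc N"
          using j N by linarith
        have "x < real (Suc j) * (h / 2)" "real j * (h / 2) \<le> x"
          using j h by (auto simp: field_simps)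
        then have ax: "x \<le> a (Suc j)" "a (Suc j) \<le> x + h"
          using a(1,2)[of "Suc j"] by (auto simp: algebra_simps)
        have "ddf_fun H (ennreal x) \<le> ddf_fun H (ennreal (a (Suc j)))"
          using ax by (intro ddf_mono ennreal_leI)
        also have "\<dots> \<le> ddf_fun G (ennreal (a (Suc j))) + h"
          using \<open>Suc j \<le> Suc N\<close> by (rule GH)
        also have "\<dots> \<le> ddf_fun G (ennreal (x + h)) + h"
          using ax by (intro add_right_mono ddf_mono ennreal_leI)
        finally show "ddf_fun H (ennreal x) \<le> ddf_fun G (ennreal (x + h)) + h" .
      qed
      have "dist (X n) F \<le> h"
      proof (intro dist_ddf_le step)
        fix j assume "j \<le> Suc N"
        then have "dist (ddf_fun (X n) (ennreal (a j))) (ddf_fun F (ennreal (a j))) < h"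
          using elim by blast
        then show "ddf_fun F (ennreal (a j)) \<le> ddf_fun (X n) (ennreal (a j)) + h"
          "ddf_fun (X n) (ennreal (a j)) \<le> ddf_fun F (ennreal (a j)) + h"
          by (auto simp: dist_real_def)
      qed (use h in auto)
      then show ?case
        using h by simp
    qed
  qed
qed

section \<open>Probabilistic normed spaces\<close>

definition triangle_function :: "(ddf \<Rightarrow> ddf \<Rightarrow> ddf) \<Rightarrow> bool" where
  "triangle_function \<tau> \<longleftrightarrow>
    (\<forall>F G. \<tau> F G = \<tau> G F) \<and>
    (\<forall>F G H. \<tau> (\<tau> F G) H = \<tau> F (\<tau> G H)) \<and>
    (\<forall>F F' G G'. F \<le> F' \<longrightarrow> G \<le> G' \<longrightarrow> \<tau> F G \<le> \<tau> F' G') \<and>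
    (\<forall>F. \<tau> F eps0 = F)"

definition PN_space ::
    "('v::real_vector \<Rightarrow> ddf) \<Rightarrow> (ddf \<Rightarrow> ddf \<Rightarrow> ddf) \<Rightarrow> (ddf \<Rightarrow> ddf \<Rightarrow> ddf) \<Rightarrow> bool" where
  "PN_space \<nu> \<tau> \<tau>' \<longleftrightarrow>
    triangle_function \<tau> \<and> triangle_function \<tau>' \<and>
    continuous_on UNIV (\<lambda>(F, G). \<tau> F G) \<and>
    (\<forall>p. \<nu> p = eps0 \<longleftrightarrow> p = 0) \<and>
    (\<forall>p. \<nu> (- p) = \<nu> p) \<and>
    (\<forall>p q. \<tau> (\<nu> p) (\<nu> q) \<le> \<nu> (p + q)) \<and>
    (\<forall>p l. 0 \<le> l \<and> l \<le> 1 \<longrightarrow> \<nu> p \<le> \<tau>' (\<nu> (l *\<^sub>R p)) (\<nu> ((1 - l) *\<^sub>R p)))"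

definition strong_nhd :: "('v::real_vector \<Rightarrow> ddf) \<Rightarrow> 'v \<Rightarrow> real \<Rightarrow> 'v set" where
  "strong_nhd \<nu> p t = {q. ddf_fun (\<nu> (p - q)) (ennreal t) > 1 - t}"

definition C_contraction :: "('v::real_vector \<Rightarrow> ddf) \<Rightarrow> ('v \<Rightarrow> 'v) \<Rightarrow> bool" where
  "C_contraction \<nu> f \<longleftrightarrow>
    (\<exists>k. 0 < k \<and> k < 1 \<and>
      (\<forall>p t. 0 < t \<longrightarrow> ddf_fun (\<nu> p) (ennreal t) > 1 - t \<longrightarrow>
        ddf_fun (\<nu> (f p)) (ennreal (k * t)) > 1 - k * t))"

end

theory Submission
  imports Defs
begin

text \<open>
  One may take \<open>\<delta> = \<epsilon>\<close>. The sets \<open>N\<^sub>\<theta>(t)\<close> grow with \<open>t\<close>, so a C-contraction with ratio \<open>k < 1\<close>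
  carries the condition defining \<open>N\<^sub>\<theta>(\<epsilon>)\<close> to the stronger one for \<open>k\<epsilon>\<close>, hence back to that for
  \<open>\<epsilon>\<close>; linearity moves this statement about the null vector to the difference of any two points.
\<close>

lemma C_contraction_preserves_level:
  assumes "C_contraction \<nu> f" and "0 < t" and "ddf_fun (\<nu> p) (ennreal t) > 1 - t"
  shows "ddf_fun (\<nu> (f p)) (ennreal t) > 1 - t"
proof -
  obtain k where k: "0 < k" "k < 1" and "ddf_fun (\<nu> (f p)) (ennreal (k * t)) > 1 - k * t"
    using assms unfolding C_contraction_def by blast
  moreover have "k * t \<le> t"
    using k assms(2) by simp
  moreover from this have "ddf_fun (\<nu> (f p)) (ennreal (k * t)) \<le> ddf_fun (\<nu> (f p)) (ennreal t)"
    by (intro ddf_mono ennreal_leI)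
  ultimately show ?thesis
    by linarith
qed

theorem theorem4p2:
  fixes \<nu> :: "'v::real_vector \<Rightarrow> ddf"
    and \<tau> \<tau>' :: "ddf \<Rightarrow> ddf \<Rightarrow> ddf"
    and f :: "'v \<Rightarrow> 'v"
  assumes "PN_space \<nu> \<tau> \<tau>'"
    and "linear f"
    and "C_contraction \<nu> f"
  shows "\<forall>\<epsilon>>0. \<exists>\<delta>>0. \<forall>p q.
           p - q \<in> strong_nhd \<nu> 0 \<delta> \<longrightarrow> f p - f q \<in> strong_nhd \<nu> 0 \<epsilon>"
proof (intro allI impI)
  fix \<epsilon> :: real assume "0 < \<epsilon>"
  have "f p - f q \<in> strong_nhd \<nu> 0 \<epsilon>" if "p - q \<in> strong_nhd \<nu> 0 \<epsilon>" for p q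
    using C_contraction_preserves_level[OF assms(3) \<open>0 < \<epsilon>\<close>, of "q - p"] that
    by (simp add: strong_nhd_def linear_diff[OF assms(2)])
  then show "\<exists>\<delta>>0. \<forall>p q. p - q \<in> strong_nhd \<nu> 0 \<delta> \<longrightarrow> f p - f q \<in> strong_nhd \<nu> 0 \<epsilon>"
    using \<open>0 < \<epsilon>\<close> by blast
qed

end
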